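(* Let $n\geq 2$, let $\eta\colon[0,1]^n\to\mathbb R$ be a $\mathbb Z$-map that is not constant on the boundary of $[0,1]^n$, and let $z\in\mathbb Z$. Then there are $\mathbb Z$-maps $\theta\colon[0,1]^n\to\mathbb R$ and $\alpha\colon[0,1]^n\to[0,1]^n$ such that $z$ belongs to the image of $\theta$ and $\theta\circ\alpha=\eta$.
   Context: A $\mathbb Z$-map $\mathbb R^m\to\mathbb R^n$ is a continuous function that agrees at each point with one of finitely many affine maps with integer coefficients; a $\mathbb Z$-map $A\to B$ ($A\subseteq\mathbb R^m$, $B\subseteq\mathbb R^n$) is a restriction to $A$ of such a map with values in $B$. *)

theory Defs
  imports "HOL-Analysis.Analysis"
begin

text \<open>
  Coefficients are taken with respect to \<open>Basis\<close>, which is the standard basis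
  on \<open>real ^ 'n\<close> and \<open>{1}\<close> on \<open>real\<close>; this covers both kinds of codomain at once.
\<close>

definition integer_affine :: "('a::euclidean_space \<Rightarrow> 'b::euclidean_space) \<Rightarrow> bool" where
  "integer_affine f \<longleftrightarrow>
     (\<exists>(A :: 'b \<Rightarrow> 'a \<Rightarrow> int) (c :: 'b \<Rightarrow> int). \<forall>x. \<forall>i\<in>Basis.
        f x \<bullet> i = (\<Sum>j\<in>Basis. of_int (A i j) * (x \<bullet> j)) + of_int (c i))"

definition Z_map :: "('a::euclidean_space \<Rightarrow> 'b::euclidean_space) \<Rightarrow> bool" where
  "Z_map g \<longleftrightarrow> continuous_on UNIV g \<and>
     (\<exists>F. finite F \<and> (\<forall>f\<in>F. integer_affine f) \<and> (\<forall>x. \<exists>f\<in>F. g x = f x))"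

text \<open>
  Only the values of \<open>f\<close> on \<open>A\<close> matter: a map \<open>A \<rightarrow> B\<close> is represented by a total function.
\<close>

definition Z_map_on ::
    "'a::euclidean_space set \<Rightarrow> 'b::euclidean_space set \<Rightarrow> ('a \<Rightarrow> 'b) \<Rightarrow> bool" where
  "Z_map_on A B f \<longleftrightarrow> (\<exists>g. Z_map g \<and> (\<forall>x\<in>A. f x = g x)) \<and> f ` A \<subseteq> B"

abbreviation unit_cube :: "(real ^ 'n) set" where
  "unit_cube \<equiv> cbox 0 1"

end

theory Submission imports Defs begin

text \<open>
  Since \<open>\<eta>\<close> is not constant on the boundary, it is not constant on some facet, so near a generic
  rational point \<open>p\<close> of that facet \<open>\<eta>\<close> is affine with gradient \<open>c\<close>, where \<open>c\<close> has a nonzero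
  component along the facet. Hence there is an integer vector \<open>v\<close> orthogonal to \<open>c\<close> that points
  into the cube. Let \<open>t \<ge> 0\<close> be a small \<open>\<int>\<close>-map supported near \<open>p\<close>, not identically zero,
  such that \<open>\<alpha> x = x + t x v\<close> leaves the support of \<open>t\<close>, that is \<open>t \<circ> \<alpha> = 0\<close>. Then
  \<open>\<eta> \<circ> \<alpha> = \<eta>\<close>, and \<open>\<theta> = \<eta> + K t\<close> satisfies \<open>\<theta> \<circ> \<alpha> = \<eta>\<close> for every integer \<open>K\<close>; for a
  suitable \<open>K\<close> the value \<open>z\<close> is attained by connectedness of the cube.
\<close>

section \<open>Integer affine functions and closure properties of \<int>-maps\<close>

lemma integer_affine_real_iff:
  fixes f :: "real ^ 'n \<Rightarrow> real"
  shows "integer_affine f \<longleftrightarrow>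
    (\<exists>(c :: 'n \<Rightarrow> int) (d :: int). \<forall>x. f x = (\<Sum>k\<in>UNIV. of_int (c k) * x $ k) + of_int d)"
proof
  have reidx: "(\<Sum>j\<in>Basis. g j) = (\<Sum>k\<in>UNIV. g (axis k 1))" for g :: "real ^ 'n \<Rightarrow> real"
  proof -
    have B: "(Basis :: (real ^ 'n) set) = range (\<lambda>k. axis k 1)" by (auto simp: Basis_vec_def)
    have "inj (\<lambda>k. axis k 1 :: real ^ 'n)" by (auto simp: inj_on_def axis_eq_axis)
    then show ?thesis unfolding B by (subst sum.reindex) auto
  qed
  {
    assume "integer_affine f"
    then obtain A c where "\<forall>x. \<forall>i\<in>Basis. f x \<bullet> i = (\<Sum>j\<in>Basis. of_int (A i j) * (x \<bullet> j)) + of_int (c i)"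
      unfolding integer_affine_def by blast
    then have "\<forall>x. f x = (\<Sum>k\<in>UNIV. of_int (A 1 (axis k 1)) * x $ k) + of_int (c 1)"
      by (simp add: reidx inner_axis)
    then show "\<exists>(c :: 'n \<Rightarrow> int) (d :: int). \<forall>x. f x = (\<Sum>k\<in>UNIV. of_int (c k) * x $ k) + of_int d"
      by (intro exI)
  next
    assume "\<exists>(c :: 'n \<Rightarrow> int) (d :: int). \<forall>x. f x = (\<Sum>k\<in>UNIV. of_int (c k) * x $ k) + of_int d"
    then obtain c :: "'n \<Rightarrow> int" and d :: int
      where "\<forall>x. f x = (\<Sum>k\<in>UNIV. of_int (c k) * x $ k) + of_int d" by blast
    then show "integer_affine f"
      unfolding integer_affine_def
      by (intro exI[of _ "\<lambda>_ b. c (axis_index b)"] exI[of _ "\<lambda>_. d"])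
         (simp add: reidx inner_axis axis_index_axis)
  }
qed

lemma integer_affine_const [intro]: "integer_affine (\<lambda>x :: real ^ 'n. of_int m :: real)"
  unfolding integer_affine_real_iff by (rule exI[of _ "\<lambda>_. 0"]) auto

lemma integer_affine_coord [intro]: "integer_affine (\<lambda>x :: real ^ 'n. x $ k)"
  unfolding integer_affine_real_iff
  by (rule exI[of _ "\<lambda>l. if l = k then 1 else 0"], rule exI[of _ 0])
     (simp add: if_distrib[of of_int] if_distrib[of "\<lambda>a. a * _"] cong: if_cong)

lemma integer_affine_add [intro]:
  fixes f g :: "real ^ 'n \<Rightarrow> real"
  assumes "integer_affine f" "integer_affine g"
  shows "integer_affine (\<lambda>x. f x + g x)"
proof -
  obtain c :: "'n \<Rightarrow> int" and d :: int and c' :: "'n \<Rightarrow> int" and d' :: int where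
    "\<And>x. f x = (\<Sum>k\<in>UNIV. of_int (c k) * x $ k) + of_int d"
    "\<And>x. g x = (\<Sum>k\<in>UNIV. of_int (c' k) * x $ k) + of_int d'"
    using assms unfolding integer_affine_real_iff by metis
  then show ?thesis
    unfolding integer_affine_real_iff
    by (intro exI[of _ "\<lambda>k. c k + c' k"] exI[of _ "d + d'"]) (simp add: algebra_simps sum.distrib)
qed

lemma integer_affine_scale [intro]:
  fixes f :: "real ^ 'n \<Rightarrow> real"
  assumes "integer_affine f"
  shows "integer_affine (\<lambda>x. of_int m * f x)"
proof -
  obtain c :: "'n \<Rightarrow> int" and d :: int where
    "\<And>x. f x = (\<Sum>k\<in>UNIV. of_int (c k) * x $ k) + of_int d"
    using assms unfolding integer_affine_real_iff by metis
  then show ?thesis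
    unfolding integer_affine_real_iff
    by (intro exI[of _ "\<lambda>k. m * c k"] exI[of _ "m * d"]) (simp add: algebra_simps sum_distrib_left)
qed

lemma Z_mapE:
  assumes "Z_map g"
  obtains F where "continuous_on UNIV g" "finite F" "\<And>f. f \<in> F \<Longrightarrow> integer_affine f"
    "\<And>x. \<exists>f\<in>F. g x = f x"
  using assms unfolding Z_map_def by auto

lemma continuous_integer_affine:
  fixes f :: "real ^ 'n \<Rightarrow> real"
  assumes "integer_affine f"
  shows "continuous_on UNIV f"
proof -
  obtain c :: "'n \<Rightarrow> int" and d :: int where
    "\<And>x. f x = (\<Sum>k\<in>UNIV. of_int (c k) * x $ k) + of_int d"
    using assms unfolding integer_affine_real_iff by metis
  then have f: "f = (\<lambda>x. (\<Sum>k\<in>UNIV. of_int (c k) * x $ k) + of_int d)" by auto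
  show ?thesis unfolding f by (intro continuous_intros)
qed

lemma Z_map_integer_affine [intro]:
  fixes f :: "real ^ 'n \<Rightarrow> real"
  shows "integer_affine f \<Longrightarrow> Z_map f"
  unfolding Z_map_def using continuous_integer_affine by (auto intro!: exI[of _ "{f}"])

lemma Z_map_add [intro]:
  fixes f g :: "real ^ 'n \<Rightarrow> real"
  assumes "Z_map f" "Z_map g"
  shows "Z_map (\<lambda>x. f x + g x)"
proof -
  obtain F where F: "continuous_on UNIV f" "finite F" "\<And>u. u \<in> F \<Longrightarrow> integer_affine u" "\<And>x. \<exists>u\<in>F. f x = u x"
    using Z_mapE[OF assms(1)] by blast
  obtain G where G: "continuous_on UNIV g" "finite G" "\<And>u. u \<in> G \<Longrightarrow> integer_affine u" "\<And>x. \<exists>u\<in>G. g x = u x"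
    using Z_mapE[OF assms(2)] by blast
  let ?H = "(\<lambda>(u, w) x. u x + w x) ` (F \<times> G)"
  have "\<exists>h\<in>?H. f x + g x = h x" for x
  proof -
    obtain u w where "u \<in> F" "f x = u x" "w \<in> G" "g x = w x" using F(4) G(4) by blast
    then show ?thesis by (intro bexI[of _ "\<lambda>x. u x + w x"]) auto
  qed
  moreover have "\<forall>h\<in>?H. integer_affine h" using F(3) G(3) by auto
  moreover have "continuous_on UNIV (\<lambda>x. f x + g x)" using F G by (intro continuous_intros)
  ultimately show ?thesis using F(2) G(2) unfolding Z_map_def by (intro conjI exI[of _ ?H]) auto
qed

lemma Z_map_scale [intro]:
  fixes f :: "real ^ 'n \<Rightarrow> real"
  assumes "Z_map f"
  shows "Z_map (\<lambda>x. of_int m * f x)"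
proof -
  obtain F where F: "continuous_on UNIV f" "finite F" "\<And>u. u \<in> F \<Longrightarrow> integer_affine u" "\<And>x. \<exists>u\<in>F. f x = u x"
    using Z_mapE[OF assms(1)] by blast
  have "\<exists>h\<in>(\<lambda>u x. of_int m * u x) ` F. of_int m * f x = h x" for x using F(4)[of x] by auto
  moreover have "continuous_on UNIV (\<lambda>x. of_int m * f x)" using F by (intro continuous_intros)
  ultimately show ?thesis using F(2,3) unfolding Z_map_def
    by (intro conjI exI[of _ "(\<lambda>u x. of_int m * u x) ` F"]) auto
qed

text \<open>At every point the maximum coincides with one of its two arguments, so the union of the
  two finite families of pieces suffices.\<close>

lemma Z_map_max [intro]:
  fixes f g :: "real ^ 'n \<Rightarrow> real"
  assumes "Z_map f" "Z_map g"
  shows "Z_map (\<lambda>x. max (f x) (g x))"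
proof -
  obtain F where F: "continuous_on UNIV f" "finite F" "\<And>u. u \<in> F \<Longrightarrow> integer_affine u" "\<And>x. \<exists>u\<in>F. f x = u x"
    using Z_mapE[OF assms(1)] by blast
  obtain G where G: "continuous_on UNIV g" "finite G" "\<And>u. u \<in> G \<Longrightarrow> integer_affine u" "\<And>x. \<exists>u\<in>G. g x = u x"
    using Z_mapE[OF assms(2)] by blast
  have "\<exists>h\<in>F \<union> G. max (f x) (g x) = h x" for x
    using F(4)[of x] G(4)[of x] unfolding max_def by (cases "f x \<le> g x") auto
  moreover have "continuous_on UNIV (\<lambda>x. max (f x) (g x))" using F G by (intro continuous_intros)
  ultimately show ?thesis using F(2,3) G(2,3) unfolding Z_map_def by (intro conjI exI[of _ "F \<union> G"]) auto
qed

lemma Z_map_const [intro]: "Z_map (\<lambda>x :: real ^ 'n. of_int m :: real)"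
  by blast

lemma Z_map_uminus [intro]:
  fixes f :: "real ^ 'n \<Rightarrow> real"
  shows "Z_map f \<Longrightarrow> Z_map (\<lambda>x. - f x)"
  using Z_map_scale[of f "-1"] by simp

lemma Z_map_diff [intro]:
  fixes f g :: "real ^ 'n \<Rightarrow> real"
  shows "Z_map f \<Longrightarrow> Z_map g \<Longrightarrow> Z_map (\<lambda>x. f x - g x)"
  using Z_map_add[of f "\<lambda>x. - g x"] by auto

lemma Z_map_min [intro]:
  fixes f g :: "real ^ 'n \<Rightarrow> real"
  assumes "Z_map f" "Z_map g"
  shows "Z_map (\<lambda>x. min (f x) (g x))"
proof -
  have "(\<lambda>x. min (f x) (g x)) = (\<lambda>x. - max (- f x) (- g x))" by auto
  then show ?thesis
    using Z_map_uminus[OF Z_map_max[OF Z_map_uminus[OF assms(1)] Z_map_uminus[OF assms(2)]]] by simp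
qed

lemma Z_map_abs [intro]:
  fixes f :: "real ^ 'n \<Rightarrow> real"
  assumes "Z_map f"
  shows "Z_map (\<lambda>x. \<bar>f x\<bar>)"
proof -
  have "(\<lambda>x. \<bar>f x\<bar>) = (\<lambda>x. max (f x) (- f x))" by auto
  then show ?thesis using Z_map_max[OF assms Z_map_uminus[OF assms]] by simp
qed

lemma Z_map_sum [intro]:
  fixes f :: "'k \<Rightarrow> real ^ 'n \<Rightarrow> real"
  assumes "\<And>k. k \<in> I \<Longrightarrow> Z_map (f k)"
  shows "Z_map (\<lambda>x. \<Sum>k\<in>I. f k x)"
  using assms Z_map_const[of 0] by (induction I rule: infinite_finite_induct) auto

text \<open>Since \<open>v\<close> is an integer vector, adding an integer affine multiple of it to
  the identity keeps all coefficients integral.\<close>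

lemma Z_map_shift:
  fixes t :: "real ^ 'n \<Rightarrow> real" and v :: "real ^ 'n"
  assumes "Z_map t" and v: "\<And>k. v $ k = of_int (w k)"
  shows "Z_map (\<lambda>x. x + t x *\<^sub>R v)"
proof -
  obtain F where F: "continuous_on UNIV t" "finite F" "\<And>u. u \<in> F \<Longrightarrow> integer_affine u" "\<And>x. \<exists>u\<in>F. t x = u x"
    using Z_mapE[OF assms(1)] by blast
  let ?H = "(\<lambda>u x. x + u x *\<^sub>R v) ` F"
  have "integer_affine (\<lambda>x. x + u x *\<^sub>R v)" if uF: "u \<in> F" for u
  proof -
    obtain A and c :: "real \<Rightarrow> int" where
      "\<forall>x. \<forall>i\<in>Basis. u x \<bullet> i = (\<Sum>j\<in>Basis. of_int (A i j) * (x \<bullet> j)) + of_int (c i)"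
      using F(3)[OF uF] unfolding integer_affine_def by blast
    then have u: "u x = (\<Sum>j\<in>Basis. of_int (A 1 j) * (x \<bullet> j)) + of_int (c 1)" for x
      by simp
    show ?thesis
      unfolding integer_affine_def
    proof (intro exI allI ballI)
      fix x b :: "real ^ 'n" assume b: "b \<in> Basis"
      then obtain k where k: "b = axis k 1" by (auto simp: Basis_vec_def)
      \<comment> \<open>The linear part is the identity plus the outer product of \<open>w\<close>
        with the gradient of \<open>u\<close>.\<close>
      have "(\<Sum>j\<in>Basis. of_int ((if j = b then 1 else 0) + w (axis_index b) * A 1 j) * (x \<bullet> j))
          = (\<Sum>j\<in>Basis. (if j = b then x \<bullet> j else 0) + w (axis_index b) * (of_int (A 1 j) * (x \<bullet> j)))"
        by (intro sum.cong) (auto simp: algebra_simps)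
      also have "\<dots> = x \<bullet> b + w (axis_index b) * (\<Sum>j\<in>Basis. of_int (A 1 j) * (x \<bullet> j))"
        using b by (simp add: sum.distrib sum_distrib_left)
      finally show "(x + u x *\<^sub>R v) \<bullet> b
          = (\<Sum>j\<in>Basis. of_int ((if j = b then 1 else 0) + w (axis_index b) * A 1 j) * (x \<bullet> j))
            + of_int (w (axis_index b) * c 1)"
        by (simp add: u k inner_add_left inner_axis axis_index_axis v algebra_simps)
    qed
  qed
  moreover have "\<exists>h\<in>?H. x + t x *\<^sub>R v = h x" for x
    using F(4)[of x] by auto
  moreover have "continuous_on UNIV (\<lambda>x. x + t x *\<^sub>R v)" using F by (intro continuous_intros)
  ultimately show ?thesis using F(2) unfolding Z_map_def by (intro conjI exI[of _ ?H]) auto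
qed

section \<open>A bump that a translation along \<open>v\<close> pushes out of its own
  support\<close>

text \<open>Clearing denominators yields integer affine functions
  \<open>of_int q * x $ k - of_int (a k)\<close> vanishing at \<open>p\<close>, from which a
  \<int>-map localized at a rational point can be built.\<close>

lemma rational_common_denominator:
  fixes p :: "real ^ 'n"
  assumes "\<And>k. p $ k \<in> \<rat>"
  obtains q :: int and a :: "'n \<Rightarrow> int" where "q > 0" "\<And>k. of_int q * p $ k = of_int (a k)"
proof -
  have "\<exists>m n :: int. n > 0 \<and> of_int n * p $ k = of_int m" for k
    using Rats_cases'[OF assms[of k]] by (metis nonzero_mult_div_cancel_left of_int_0_eq_iff order_less_irrefl times_divide_eq_right)
  then obtain m n :: "'n \<Rightarrow> int" where mn: "\<And>k. n k > 0" "\<And>k. of_int (n k) * p $ k = of_int (m k)"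
    by metis
  show ?thesis
  proof (rule that)
    show "(\<Prod>k\<in>UNIV. n k) > 0" using mn by (simp add: prod_pos)
    fix k
    have "(\<Prod>k\<in>UNIV. n k) = (\<Prod>l\<in>UNIV - {k}. n l) * n k" by (simp add: prod.remove[of UNIV k])
    then show "of_int (\<Prod>k\<in>UNIV. n k) * p $ k = of_int ((\<Prod>l\<in>UNIV - {k}. n l) * m k)"
      using mn(2)[of k] by (simp add: mult.assoc)
  qed
qed

text \<open>The function \<open>t\<close> is the positive part of a bump \<open>h\<close>, constant
  along \<open>v\<close>, minus the distance \<open>s\<close> to the facet. A shift along the inward
  vector \<open>v\<close> increases \<open>s\<close> at least as fast as the shift parameter, so a
  shift by \<open>t x\<close> uses up the whole excess of \<open>h\<close> over \<open>s\<close>. A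
  narrow and low \<open>h\<close> confines everything to a small neighbourhood of
  \<open>p\<close>.\<close>

lemma absorbing_shift:
  fixes c :: "'n::finite \<Rightarrow> int" and p :: "real ^ 'n" and T :: int and \<epsilon> :: real
  assumes ij: "i \<noteq> j" and cj: "c j \<noteq> 0" and rat: "\<And>k. p $ k \<in> \<rat>"
    and T: "T = 0 \<or> T = 1" and pi: "p $ i = of_int T"
    and inner: "\<And>k. k \<noteq> i \<Longrightarrow> 0 < p $ k \<and> p $ k < 1" and \<epsilon>: "\<epsilon> > 0"
  obtains t v and w :: "'n \<Rightarrow> int" where "Z_map t" "\<And>k. v $ k = of_int (w k)"
    "(\<Sum>k\<in>UNIV. of_int (c k) * v $ k) = 0"
    "\<And>x. t x \<ge> 0" "\<exists>y\<in>unit_cube. t y > 0" "\<And>x. t (x + t x *\<^sub>R v) = 0"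
    "\<And>x. x \<in> unit_cube \<Longrightarrow> t x > 0 \<Longrightarrow> x + t x *\<^sub>R v \<in> unit_cube \<and>
       (\<forall>k. \<bar>x $ k - p $ k\<bar> < \<epsilon> \<and> \<bar>(x + t x *\<^sub>R v) $ k - p $ k\<bar> < \<epsilon>)"
proof -
  obtain q a where q: "q > 0" and qa: "\<And>k. of_int q * p $ k = of_int (a k :: int)"
    using rational_common_denominator[OF rat] by blast
  have q1: "real_of_int q \<ge> 1" using q by simp
  \<comment> \<open>Deviations from \<open>p\<close> below \<open>e\<close> stay clear of all facets
    except the one through \<open>p\<close>; the bound 1 takes care of the opposite facet.\<close>
  obtain e where e: "e > 0" "e \<le> \<epsilon>" "e \<le> 1" "\<And>k. k \<noteq> i \<Longrightarrow> e \<le> p $ k \<and> e \<le> 1 - p $ k"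
  proof -
    let ?S = "{\<epsilon>, 1} \<union> (\<lambda>k. p $ k) ` (- {i}) \<union> (\<lambda>k. 1 - p $ k) ` (- {i})"
    show ?thesis
    proof (rule that[of "Min ?S"])
      show "Min ?S > 0" using \<epsilon> inner by (subst Min_gr_iff) (auto, meson)
      show "Min ?S \<le> \<epsilon>" "Min ?S \<le> 1" by (rule Min_le; simp)+
      show "Min ?S \<le> p $ k \<and> Min ?S \<le> 1 - p $ k" if "k \<noteq> i" for k
        using that by (intro conjI Min_le) auto
    qed
  qed
  \<comment> \<open>The sign of the inward direction at the facet: 1 for \<open>T = 0\<close> and -1
    for \<open>T = 1\<close>.\<close>
  define \<sigma> :: int where "\<sigma> = 1 - 2 * T"
  have \<sigma>: "\<sigma> = 1 \<or> \<sigma> = -1" using T unfolding \<sigma>_def by auto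
  \<comment> \<open>An integer vector in the plane of the axes \<open>i\<close> and
    \<open>j\<close>: the entry at \<open>i\<close> points into the cube because \<open>c j\<close>
    is nonzero, and the entry at \<open>j\<close> restores orthogonality to
    \<open>c\<close>.\<close>
  define w where "w = (\<lambda>k. if k = i then \<sigma> * \<bar>c j\<bar> else if k = j then - \<sigma> * sgn (c j) * c i else 0)"
  define v :: "real ^ 'n" where "v = (\<chi> k. of_int (w k))"
  have v: "v $ k = of_int (w k)" for k by (simp add: v_def)
  have cv: "(\<Sum>k\<in>UNIV. of_int (c k) * v $ k) = 0"
  proof -
    have "(\<Sum>k\<in>UNIV. of_int (c k) * v $ k) = (\<Sum>k\<in>{i, j}. of_int (c k) * v $ k)"
      by (rule sum.mono_neutral_right) (auto simp: v w_def)
    also have "\<dots> = of_int (\<sigma> * c i * (\<bar>c j\<bar> - sgn (c j) * c j))"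
      using ij by (simp add: v w_def algebra_simps)
    also have "sgn (c j) * c j = \<bar>c j\<bar>" by (simp add: abs_sgn mult.commute)
    finally show ?thesis by simp
  qed
  \<comment> \<open>Every coordinate of \<open>x\<close> and of its shift will deviate from
    \<open>p\<close> by at most \<open>C / N\<close>: the first two summands account for the
    deviation of \<open>x\<close>, the last one for the displacement.\<close>
  define C where "C = 1 + (\<Sum>k\<in>UNIV. \<bar>real_of_int (c k)\<bar>) + (\<Sum>k\<in>UNIV. \<bar>v $ k\<bar>)"
  have C: "C \<ge> 1" unfolding C_def by (simp add: sum_nonneg add_nonneg_nonneg)
  obtain N0 :: nat where N0: "real N0 > C / e" using reals_Archimedean2 by blast
  define N where "N = int N0"
  have "C / e > 0" using C e by simp
  then have N: "real_of_int N > 0" using N0 unfolding N_def by linarith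
  have CN: "C / N < e" using N0 N e(1) by (simp add: N_def field_simps)
  txt \<open>Up to a factor, \<open>D\<close> is a distance from \<open>p\<close> in the coordinates that are invariant under
    translation by \<open>v\<close>. Taking the minimum with \<open>D\<close> itself makes the bump \<open>h\<close> have height at most
    \<open>1 / N\<close> in spite of its integer coefficients, at the price of vanishing at \<open>p\<close>.\<close>
  define s where "s = (\<lambda>x :: real ^ 'n. of_int \<sigma> * (x $ i - of_int T))"
  define D where "D = (\<lambda>x :: real ^ 'n. (\<Sum>k\<in>UNIV - {i, j}. \<bar>of_int q * x $ k - of_int (a k)\<bar>)
     + \<bar>\<Sum>k\<in>UNIV. of_int (c k) * (of_int q * x $ k - of_int (a k))\<bar>)"
  define h where "h = (\<lambda>x. max (of_int 0) (min (D x) (of_int 1 - of_int N * D x)))"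
  define t where "t = (\<lambda>x. max (of_int 0) (h x - s x))"
  have coord: "Z_map (\<lambda>x :: real ^ 'n. of_int q * x $ k - of_int (a k))" for k
    by (intro Z_map_diff Z_map_scale Z_map_const Z_map_integer_affine integer_affine_coord)
  have ZD: "Z_map D"
    unfolding D_def by (intro Z_map_add Z_map_sum Z_map_abs Z_map_scale coord)
  have Zt: "Z_map t"
    unfolding t_def h_def s_def
    by (intro Z_map_max Z_map_const Z_map_diff Z_map_min Z_map_scale ZD Z_map_integer_affine integer_affine_coord)
  have D_eq: "D x = of_int q * ((\<Sum>k\<in>UNIV - {i, j}. \<bar>x $ k - p $ k\<bar>)
     + \<bar>\<Sum>k\<in>UNIV. of_int (c k) * (x $ k - p $ k)\<bar>)" for x
  proof -
    have "of_int q * x $ k - of_int (a k) = of_int q * (x $ k - p $ k)" for k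
      by (simp add: qa[symmetric] algebra_simps)
    moreover have "(\<Sum>k\<in>UNIV. of_int (c k) * (of_int q * (x $ k - p $ k)))
       = of_int q * (\<Sum>k\<in>UNIV. of_int (c k) * (x $ k - p $ k))"
      by (simp add: sum_distrib_left algebra_simps)
    ultimately show ?thesis
      using q unfolding D_def by (simp add: abs_mult sum_distrib_left[symmetric] distrib_left)
  qed
  have D_inv: "D (x + r *\<^sub>R v) = D x" for x r
  proof -
    have "(\<Sum>k\<in>UNIV. of_int (c k) * ((x + r *\<^sub>R v) $ k - p $ k))
       = (\<Sum>k\<in>UNIV. of_int (c k) * (x $ k - p $ k)) + r * (\<Sum>k\<in>UNIV. of_int (c k) * v $ k)"
      by (simp add: algebra_simps sum.distrib sum_subtractf sum_distrib_left)
    moreover have "(\<Sum>k\<in>UNIV - {i, j}. \<bar>(x + r *\<^sub>R v) $ k - p $ k\<bar>) = (\<Sum>k\<in>UNIV - {i, j}. \<bar>x $ k - p $ k\<bar>)"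
      by (rule sum.cong) (auto simp: v w_def)
    ultimately show ?thesis unfolding D_eq cv by simp
  qed
  have s_shift: "s (x + r *\<^sub>R v) = s x + r * \<bar>of_int (c j)\<bar>" for x r
    using \<sigma> by (auto simp: s_def v w_def algebra_simps)
  have cj1: "\<bar>real_of_int (c j)\<bar> \<ge> 1" using cj by linarith
  have t0: "t x \<ge> 0" for x by (simp add: t_def)
  have t_abs: "t (x + t x *\<^sub>R v) = 0" for x
  proof -
    \<comment> \<open>While \<open>h\<close> stays fixed, \<open>s\<close> grows by
      \<open>t x * \<bar>c j\<bar>\<close>. Integrality gives
      \<open>\<bar>c j\<bar> \<ge> 1\<close>, so the growth is at least
      \<open>h x - s x\<close>.\<close>
    have "h (x + t x *\<^sub>R v) = h x" by (simp add: h_def D_inv)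
    moreover have "t x * \<bar>of_int (c j)\<bar> \<ge> t x * 1" using cj1 t0 by (intro mult_left_mono) auto
    moreover have "t x \<ge> h x - s x" by (simp add: t_def)
    ultimately show ?thesis by (simp add: t_def s_shift)
  qed
  have near: "x + t x *\<^sub>R v \<in> unit_cube \<and>
       (\<forall>k. \<bar>x $ k - p $ k\<bar> < \<epsilon> \<and> \<bar>(x + t x *\<^sub>R v) $ k - p $ k\<bar> < \<epsilon>)"
    if x: "x \<in> unit_cube" and tx: "t x > 0" for x
  proof -
    have x01: "0 \<le> x $ k" "x $ k \<le> 1" for k using x by (auto simp: mem_box_cart)
    have s0: "s x \<ge> 0" using T x01[of i] by (auto simp: s_def \<sigma>_def)
    \<comment> \<open>Positivity of \<open>h x\<close> makes both entries of the minimum positive,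
      whence \<open>h x \<le> D x < 1 / N\<close>; this controls the height \<open>t x\<close> and
      the distance \<open>s x\<close> at once.\<close>
    have hx: "h x > 0" "h x > s x" "t x \<le> h x" using tx s0 by (auto simp: t_def)
    then have "N * D x < 1" "h x \<le> D x" by (auto simp: h_def)
    then have DN: "D x < 1 / N" using N by (simp add: field_simps)
    have tN: "t x \<le> 1 / N" "s x < 1 / N" using hx \<open>h x \<le> D x\<close> DN by linarith+
    let ?E = "\<Sum>k\<in>UNIV. of_int (c k) * (x $ k - p $ k)"
    let ?R = "\<Sum>k\<in>UNIV - {i, j}. \<bar>x $ k - p $ k\<bar>"
    have R0: "?R \<ge> 0" by (simp add: sum_nonneg)
    have "1 * (?R + \<bar>?E\<bar>) \<le> of_int q * (?R + \<bar>?E\<bar>)" using q1 R0 by (intro mult_right_mono) auto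
    then have RE: "?R + \<bar>?E\<bar> < 1 / N" using DN unfolding D_eq mult_1 by (rule le_less_trans)
    have small: "\<bar>x $ k - p $ k\<bar> \<le> 1 / N" if "k \<noteq> j" for k
    proof (cases "k = i")
      case True
      have "s x = \<bar>x $ i - p $ i\<bar>" using T x01[of i] by (auto simp: s_def \<sigma>_def pi)
      then show ?thesis using True tN by simp
    next
      case False
      then have "\<bar>x $ k - p $ k\<bar> \<le> ?R" using that by (intro member_le_sum) auto
      then show ?thesis using RE by linarith
    qed
    have S: "(\<Sum>k\<in>UNIV - {j}. \<bar>of_int (c k)\<bar> * \<bar>x $ k - p $ k\<bar>) \<le> (\<Sum>k\<in>UNIV. \<bar>real_of_int (c k)\<bar>) * (1 / N)"
    proof -
      have "(\<Sum>k\<in>UNIV - {j}. \<bar>of_int (c k)\<bar> * \<bar>x $ k - p $ k\<bar>) \<le> (\<Sum>k\<in>UNIV - {j}. \<bar>real_of_int (c k)\<bar> * (1 / N))"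
        using small by (intro sum_mono mult_left_mono) auto
      also have "\<dots> \<le> (\<Sum>k\<in>UNIV. \<bar>real_of_int (c k)\<bar> * (1 / N))"
        using N by (intro sum_mono2) auto
      finally show ?thesis unfolding sum_distrib_right .
    qed
    \<comment> \<open>Coordinate \<open>j\<close> has no term of its own in \<open>D\<close>. It is
      recovered from the bound on \<open>?E\<close> once the other coordinates are known to be
      small, since \<open>c j\<close> is a nonzero integer.\<close>
    have "?E = of_int (c j) * (x $ j - p $ j) + (\<Sum>k\<in>UNIV - {j}. of_int (c k) * (x $ k - p $ k))"
      by (simp add: sum.remove[of UNIV j])
    moreover have "\<bar>\<Sum>k\<in>UNIV - {j}. of_int (c k) * (x $ k - p $ k)\<bar> \<le> (\<Sum>k\<in>UNIV - {j}. \<bar>of_int (c k)\<bar> * \<bar>x $ k - p $ k\<bar>)"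
      by (rule order_trans[OF sum_abs]) (simp add: abs_mult)
    ultimately have "\<bar>of_int (c j) * (x $ j - p $ j)\<bar> \<le> 1 / N + (\<Sum>k\<in>UNIV. \<bar>real_of_int (c k)\<bar>) * (1 / N)"
      using RE R0 S by linarith
    moreover have "1 * \<bar>x $ j - p $ j\<bar> \<le> \<bar>of_int (c j)\<bar> * \<bar>x $ j - p $ j\<bar>"
      using cj1 by (intro mult_right_mono) auto
    ultimately have smallj: "\<bar>x $ j - p $ j\<bar> \<le> (1 + (\<Sum>k\<in>UNIV. \<bar>real_of_int (c k)\<bar>)) * (1 / N)"
      by (simp add: abs_mult add_divide_distrib)
    have all: "\<bar>x $ k - p $ k\<bar> \<le> (1 + (\<Sum>k\<in>UNIV. \<bar>real_of_int (c k)\<bar>)) * (1 / N)" for k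
    proof (cases "k = j")
      case False
      have "1 * (1 / N) \<le> (1 + (\<Sum>k\<in>UNIV. \<bar>real_of_int (c k)\<bar>)) * (1 / N)"
        using N by (intro mult_right_mono) (auto simp: sum_nonneg)
      then show ?thesis using small[OF False] by linarith
    qed (use smallj in simp)
    have near': "\<bar>x $ k - p $ k\<bar> + t x * \<bar>v $ k\<bar> < e" for k
    proof -
      have "t x * \<bar>v $ k\<bar> \<le> (1 / N) * (\<Sum>k\<in>UNIV. \<bar>v $ k\<bar>)"
        using tN N by (intro mult_mono member_le_sum) auto
      then have "\<bar>x $ k - p $ k\<bar> + t x * \<bar>v $ k\<bar> \<le> C / N"
        using all[of k] by (simp add: C_def add_divide_distrib)
      then show ?thesis using CN by linarith
    qed
    have n1: "\<bar>x $ k - p $ k\<bar> < e" for k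
      using near'[of k] mult_nonneg_nonneg[OF t0[of x] abs_ge_zero[of "v $ k"]] by linarith
    have n2: "\<bar>(x + t x *\<^sub>R v) $ k - p $ k\<bar> < e" for k
    proof -
      have "\<bar>t x * v $ k\<bar> = t x * \<bar>v $ k\<bar>" using t0[of x] by (simp add: abs_mult)
      then show ?thesis using near'[of k] by simp
    qed
    have "0 \<le> (x + t x *\<^sub>R v) $ k \<and> (x + t x *\<^sub>R v) $ k \<le> 1" for k
    proof (cases "k = i")
      case False
      then show ?thesis using n2[of k] e(4)[OF False] by linarith
    next
      case True
      \<comment> \<open>Closeness to \<open>p\<close> cannot settle coordinate \<open>i\<close>, as
        \<open>p\<close> lies on the facet itself; here the inward direction of \<open>v\<close> is
        what keeps the point in the cube.\<close>
      have "s (x + t x *\<^sub>R v) \<ge> 0" using s0 t0[of x] unfolding s_shift by simp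
      then show ?thesis using n2[of k] e(3) T unfolding True pi s_def \<sigma>_def by auto
    qed
    then show ?thesis using n1 n2 e(2) by (auto simp: mem_box_cart intro: less_le_trans)
  qed
  have "\<exists>y\<in>unit_cube. t y > 0"
  proof -
    \<comment> \<open>The witness moves \<open>p\<close> by a small \<open>\<delta>\<close> along
      axis \<open>j\<close>. It remains on the facet, so \<open>s\<close> vanishes, while
      \<open>D\<close> becomes \<open>M * \<delta>\<close>, which is positive and at most
      \<open>1 / (2 * N)\<close>.\<close>
    define M where "M = of_int q * \<bar>real_of_int (c j)\<bar>"
    have M: "M > 0" using q cj by (simp add: M_def)
    define \<delta> where "\<delta> = min (e / 2) (1 / (2 * N * M))"
    have "\<delta> \<le> e / 2" unfolding \<delta>_def by (rule min.cobounded1)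
    moreover have "\<delta> > 0" using e N M by (simp add: \<delta>_def)
    ultimately have \<delta>: "\<delta> > 0" "\<delta> < e" using e(1) by linarith+
    define y where "y = (\<chi> k. if k = j then p $ j + \<delta> else p $ k)"
    have "(\<Sum>k\<in>UNIV. of_int (c k) * (y $ k - p $ k)) = (\<Sum>k\<in>{j}. of_int (c k) * (y $ k - p $ k))"
      by (rule sum.mono_neutral_right) (auto simp: y_def)
    moreover have "(\<Sum>k\<in>UNIV - {i, j}. \<bar>y $ k - p $ k\<bar>) = 0" by (rule sum.neutral) (auto simp: y_def)
    ultimately have Dy: "D y = M * \<delta>" using \<delta> by (simp add: D_eq y_def M_def abs_mult)
    have "N * (M * \<delta>) \<le> N * (M * (1 / (2 * N * M)))"
      using N M by (intro mult_left_mono) (auto simp: \<delta>_def)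
    also have "\<dots> = 1 / 2" using N M by simp
    finally have "N * D y < 1" unfolding Dy by simp
    moreover have "D y > 0" using M \<delta> by (simp add: Dy)
    ultimately have "h y > 0" by (simp add: h_def)
    moreover have "s y = 0" using ij pi by (simp add: s_def y_def)
    ultimately have "t y > 0" by (simp add: t_def)
    moreover have "y \<in> unit_cube"
    proof -
      have "0 \<le> y $ k \<and> y $ k \<le> 1" for k
        using inner[of k] e(4)[of j] \<delta> ij T pi by (cases "k = i") (auto simp: y_def)
      then show ?thesis by (auto simp: mem_box_cart)
    qed
    ultimately show ?thesis by blast
  qed
  then show ?thesis using that[OF Zt v cv t0 _ t_abs near] by blast
qed

section \<open>Local affineness on the inner side of a facet\<close>

text \<open>The Euclidean distance is at most the sum of the coordinate deviations, so dividing a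
  radius by more than the dimension suffices.\<close>

lemma open_contains_sup_ball:
  fixes p :: "real ^ 'n"
  assumes "open U" "p \<in> U"
  obtains \<epsilon> where "\<epsilon> > 0" "\<And>x. (\<And>k. \<bar>x $ k - p $ k\<bar> < \<epsilon>) \<Longrightarrow> x \<in> U"
proof -
  obtain r where r: "r > 0" "ball p r \<subseteq> U" using assms open_contains_ball by metis
  show ?thesis
  proof (rule that)
    show "r / (real CARD('n) + 1) > 0" using r by simp
    fix x :: "real ^ 'n"
    assume x: "\<And>k. \<bar>x $ k - p $ k\<bar> < r / (real CARD('n) + 1)"
    have "dist p x \<le> (\<Sum>k\<in>UNIV. \<bar>(x - p) $ k\<bar>)" by (metis dist_commute dist_norm norm_le_l1_cart)
    also have "\<dots> \<le> of_nat CARD('n) * (r / (real CARD('n) + 1))"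
      by (rule sum_bounded_above) (use x in \<open>simp add: less_imp_le\<close>)
    also have "\<dots> < r" using r by (simp add: field_simps)
    finally show "x \<in> U" using r by auto
  qed
qed

text \<open>A generic rational point of the facet has the required property. The formula is claimed
  only inside the cube because \<open>G\<close> may bend across the facet; on the inner side,
  finitely many possible normal slopes and connectedness leave just one.\<close>

lemma locally_affine_at_facet:
  fixes G :: "real ^ 'n \<Rightarrow> real" and T :: int
  assumes G: "Z_map G" and T: "T = 0 \<or> T = 1"
    and nc: "\<not> G constant_on {x \<in> unit_cube. x $ i = of_int T}"
  obtains p :: "real ^ 'n" and c :: "'n \<Rightarrow> int" and d :: int and j \<epsilon>
  where "i \<noteq> j" "c j \<noteq> 0" "\<And>k. p $ k \<in> \<rat>" "p $ i = of_int T"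
    "\<And>k. k \<noteq> i \<Longrightarrow> 0 < p $ k \<and> p $ k < 1" "\<epsilon> > 0"
    "\<And>x. x \<in> unit_cube \<Longrightarrow> \<forall>k. \<bar>x $ k - p $ k\<bar> < \<epsilon> \<Longrightarrow>
       G x = (\<Sum>k\<in>UNIV. of_int (c k) * x $ k) + of_int d"
proof -
  obtain F where F: "continuous_on UNIV G" "finite F" "\<And>f. f \<in> F \<Longrightarrow> integer_affine f"
    "\<And>x. \<exists>f\<in>F. G x = f x"
    using Z_mapE[OF G] by blast
  define Q where "Q = {x \<in> unit_cube. x $ i = real_of_int T}"
  have convQ: "convex Q"
  proof -
    have "Q = unit_cube \<inter> {x. axis i 1 \<bullet> x = real_of_int T}" by (auto simp: Q_def inner_axis')
    then show ?thesis by (simp add: convex_Int convex_hyperplane)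
  qed
  \<comment> \<open>The values of those pieces that are constant on the facet. There are finitely
    many, whereas a nonconstant continuous function on the connected set \<open>Q\<close> has
    infinitely many values, so \<open>G\<close> escapes \<open>V\<close> somewhere.\<close>
  define V where "V = {y. \<exists>f\<in>F. \<forall>x\<in>Q. f x = y}"
  have "Q \<noteq> {}" using nc unfolding Q_def[symmetric] constant_on_def by auto
  then obtain q0 where "q0 \<in> Q" by auto
  then have "V \<subseteq> (\<lambda>f. f q0) ` F" by (auto simp: V_def)
  then have finV: "finite V" using F(2) finite_surj by blast
  have "\<exists>x0\<in>Q. G x0 \<notin> V"
  proof (rule ccontr)
    assume "\<not> ?thesis"
    then have "G ` Q \<subseteq> V" by blast
    then have "finite (G ` Q)" using finV by (rule finite_subset)
    moreover have "connected Q" using convQ by (rule convex_connected)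
    moreover have "continuous_on Q G" using F(1) continuous_on_subset by blast
    ultimately show False
      using nc continuous_finite_range_constant[of Q G] unfolding Q_def[symmetric] by blast
  qed
  then obtain x0 where x0: "x0 \<in> Q" "G x0 \<notin> V" by blast
  define W where "W = {x. G x \<notin> V}"
  have openW: "open W"
  proof -
    have "open (G -` (- V))" using F(1) finV by (intro open_vimage) (auto intro: finite_imp_closed)
    then show ?thesis by (simp add: W_def vimage_def)
  qed
  \<comment> \<open>Rational points in the relative interior of the facet whose value avoids
    \<open>V\<close>: a piece active at such a point cannot be constant on the facet.\<close>
  define R where "R = {p :: real ^ 'n. p \<in> W \<and> (\<forall>k. p $ k \<in> \<rat>) \<and> p $ i = of_int T \<and>
     (\<forall>k. k \<noteq> i \<longrightarrow> 0 < p $ k \<and> p $ k < 1)}"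
  define A where "A = (\<lambda>p. {f \<in> F. f p = G p})"
  have finA: "finite (A x)" for x using F(2) by (simp add: A_def)
  have "\<exists>p. p \<in> R"
  proof -
    have "x0 \<in> W" using x0 by (simp add: W_def)
    then obtain \<delta> where \<delta>: "\<delta> > 0" "\<And>x. (\<And>k. \<bar>x $ k - x0 $ k\<bar> < \<delta>) \<Longrightarrow> x \<in> W"
      using open_contains_sup_ball[OF openW] by metis
    have x01: "0 \<le> x0 $ k" "x0 $ k \<le> 1" for k using x0 by (auto simp: Q_def mem_box_cart)
    have "\<exists>r\<in>\<rat>. 0 < r \<and> r < 1 \<and> \<bar>r - x0 $ k\<bar> < \<delta>" for k
    proof -
      have "max 0 (x0 $ k - \<delta>) < min 1 (x0 $ k + \<delta>)" using x01[of k] \<delta> by auto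
      then obtain r where "r \<in> \<rat>" "max 0 (x0 $ k - \<delta>) < r" "r < min 1 (x0 $ k + \<delta>)"
        using Rats_dense_in_real by blast
      then show ?thesis by (intro bexI[of _ r]) auto
    qed
    then obtain r where r: "\<And>k. r k \<in> \<rat> \<and> 0 < r k \<and> r k < 1 \<and> \<bar>r k - x0 $ k\<bar> < \<delta>" by metis
    have "(\<chi> k. if k = i then of_int T else r k) \<in> R"
      unfolding R_def using r \<delta>(1) x0 by (auto simp: Q_def intro!: \<delta>(2))
    then show ?thesis by blast
  qed
  txt \<open>At a point where the number of active affine pieces is minimal, all of these pieces agree along the
    facet, hence differ only by multiples of the distance to it.\<close>
  then obtain p where p: "p \<in> R" and pmin: "\<And>y. y \<in> R \<Longrightarrow> card (A p) \<le> card (A y)"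
    using ex_has_least_nat[of "\<lambda>p. p \<in> R" _ "\<lambda>p. card (A p)"] by blast
  have pW: "p \<in> W" and prat: "\<And>k. p $ k \<in> \<rat>" and pi: "p $ i = of_int T"
    and p01: "\<And>k. k \<noteq> i \<Longrightarrow> 0 < p $ k \<and> p $ k < 1"
    using p by (auto simp: R_def)
  \<comment> \<open>On \<open>U\<close> no piece inactive at \<open>p\<close> becomes active. By
    minimality the active pieces are therefore exactly those of \<open>p\<close> at all points of
    \<open>U\<close> that belong to \<open>R\<close>. The coordinate bounds keep perturbations along
    the facet in \<open>R\<close>.\<close>
  define U where "U = W \<inter> (\<Inter>f\<in>F - A p. {x. f x \<noteq> G x}) \<inter> (\<Inter>k\<in>- {i}. {x. 0 < x $ k} \<inter> {x. x $ k < 1})"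
  have "open {x. f x \<noteq> G x}" if "f \<in> F" for f
    using continuous_integer_affine[OF F(3)[OF that]] F(1) by (rule open_Collect_neq)
  then have "open U"
    unfolding U_def using F(2) openW
    by (intro open_Int open_INT ballI open_Collect_less continuous_intros) auto
  moreover have "p \<in> U" using pW p01 by (auto simp: U_def A_def)
  ultimately obtain \<epsilon> where \<epsilon>: "\<epsilon> > 0" "\<And>x. (\<And>k. \<bar>x $ k - p $ k\<bar> < \<epsilon>) \<Longrightarrow> x \<in> U"
    using open_contains_sup_ball by metis
  have A_U: "A x \<subseteq> A p" if "x \<in> U" for x using that by (auto simp: U_def A_def)
  have A_R: "A x = A p" if "x \<in> U" "x \<in> R" for x
    using A_U[OF that(1)] pmin[OF that(2)] finA by (intro card_seteq)
  obtain f0 where f0: "f0 \<in> F" "G p = f0 p" using F(4) by blast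
  obtain c :: "'n \<Rightarrow> int" and d :: int where
    c: "\<And>x. f0 x = (\<Sum>k\<in>UNIV. of_int (c k) * x $ k) + of_int d"
    using F(3)[OF f0(1)] unfolding integer_affine_real_iff by metis
  have "\<exists>j. j \<noteq> i \<and> c j \<noteq> 0"
  proof (rule ccontr)
    assume "\<not> ?thesis"
    then have c0: "c k = 0" if "k \<noteq> i" for k using that by blast
    have "f0 x = of_int (c i) * x $ i + of_int d" for x
    proof -
      have "(\<Sum>k\<in>UNIV. of_int (c k) * x $ k) = (\<Sum>k\<in>{i}. of_int (c k) * x $ k)"
        by (rule sum.mono_neutral_right) (use c0 in auto)
      then show ?thesis by (simp add: c)
    qed
    then have "\<forall>x\<in>Q. f0 x = G p" unfolding f0(2) by (simp add: Q_def pi)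
    then show False using pW f0(1) unfolding W_def V_def by blast
  qed
  then obtain j where j: "j \<noteq> i" "c j \<noteq> 0" by blast
  have "\<exists>m :: int. \<forall>x. f x = f0 x + of_int m * (x $ i - of_int T)" if f: "f \<in> A p" for f
  proof -
    have "f \<in> F" "f p = G p" using f by (auto simp: A_def)
    then obtain c' :: "'n \<Rightarrow> int" and d' :: int where
      c': "\<And>x. f x = (\<Sum>k\<in>UNIV. of_int (c' k) * x $ k) + of_int d'"
      using F(3) unfolding integer_affine_real_iff by metis
    have diff: "f x - f0 x = (\<Sum>k\<in>UNIV. of_int (c' k - c k) * x $ k) + of_int (d' - d)" for x
      by (simp add: c c' sum_subtractf left_diff_distrib)
    have eqc: "c' k = c k" if k: "k \<noteq> i" for k
    proof -
      \<comment> \<open>A rational step along axis \<open>k\<close> stays in \<open>R\<close> and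
        \<open>U\<close>, so \<open>f\<close> and \<open>f0\<close> agree at both ends and their
        coefficients at \<open>k\<close> must coincide.\<close>
      obtain \<delta> where \<delta>: "\<delta> \<in> \<rat>" "0 < \<delta>" "\<delta> < \<epsilon>" using Rats_dense_in_real[OF \<epsilon>(1)] by blast
      define y where "y = (\<chi> l. if l = k then p $ k + \<delta> else p $ l)"
      have yU: "y \<in> U" using \<delta> \<epsilon>(1) by (intro \<epsilon>(2)) (auto simp: y_def)
      moreover have "y \<in> R"
        using yU k pi prat \<delta>(1) unfolding R_def U_def by (auto simp: y_def)
      ultimately have "A y = A p" by (rule A_R)
      then have "f \<in> A y" "f0 \<in> A y" using f f0 by (auto simp: A_def)
      then have "f y - f0 y = f p - f0 p" using \<open>f p = G p\<close> f0(2) by (simp add: A_def)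
      then have "(\<Sum>l\<in>UNIV. of_int (c' l - c l) * (y $ l - p $ l)) = 0"
        unfolding diff right_diff_distrib sum_subtractf by simp
      moreover have "(\<Sum>l\<in>UNIV. of_int (c' l - c l) * (y $ l - p $ l))
          = (\<Sum>l\<in>{k}. of_int (c' l - c l) * (y $ l - p $ l))"
        by (rule sum.mono_neutral_right) (auto simp: y_def)
      ultimately show ?thesis using \<delta> by (simp add: y_def)
    qed
    have diff': "f x - f0 x = of_int (c' i - c i) * x $ i + of_int (d' - d)" for x
    proof -
      have "(\<Sum>k\<in>UNIV. of_int (c' k - c k) * x $ k) = (\<Sum>k\<in>{i}. of_int (c' k - c k) * x $ k)"
        by (rule sum.mono_neutral_right) (use eqc in auto)
      then show ?thesis unfolding diff by simp
    qed
    have "real_of_int (d' - d) = - of_int (c' i - c i) * of_int T"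
      using diff'[of p] \<open>f p = G p\<close> f0(2) pi by (simp add: algebra_simps)
    then have "f x = f0 x + of_int (c' i - c i) * (x $ i - of_int T)" for x
      using diff'[of x] by (simp add: algebra_simps)
    then show ?thesis by blast
  qed
  then obtain m where m: "\<And>f x. f \<in> A p \<Longrightarrow> f x = f0 x + of_int (m f :: int) * (x $ i - of_int T)" by metis
  have Gm: "\<exists>f\<in>A p. G x = f0 x + of_int (m f) * (x $ i - of_int T)"
    if x: "\<forall>k. \<bar>x $ k - p $ k\<bar> < \<epsilon>" for x
  proof -
    obtain f where f: "f \<in> F" "G x = f x" using F(4) by blast
    then have "f \<in> A p" using A_U[OF \<epsilon>(2), of x] x by (auto simp: A_def)
    then show ?thesis using f m by metis
  qed
  \<comment> \<open>\<open>B\<close> is the part of the box around \<open>p\<close> strictly on the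
    inner side of the facet: it is convex, hence connected, and \<open>x $ i - of_int T\<close> does
    not vanish on it.\<close>
  define \<sigma> :: real where "\<sigma> = 1 - 2 * of_int T"
  define B where "B = box (\<chi> k. p $ k - \<epsilon>) (\<chi> k. p $ k + \<epsilon>) \<inter> {x. axis i \<sigma> \<bullet> x > \<sigma> * of_int T}"
  have B: "x \<in> B \<longleftrightarrow> (\<forall>k. \<bar>x $ k - p $ k\<bar> < \<epsilon>) \<and> \<sigma> * of_int T < \<sigma> * x $ i" for x
    by (auto simp: B_def mem_box_cart abs_diff_less_iff inner_axis')
  have Bi: "x $ i \<noteq> of_int T" if "x \<in> B" for x using that T by (auto simp: B)
  \<comment> \<open>The normal slope of \<open>G\<close> relative to \<open>f0\<close>. It is
    continuous on \<open>B\<close> and takes only the finitely many integer values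
    \<open>m f\<close>, hence is constant.\<close>
  define \<mu> where "\<mu> = (\<lambda>x. (G x - f0 x) / (x $ i - of_int T))"
  have \<mu>: "\<mu> x \<in> (\<lambda>f. of_int (m f)) ` A p" if x: "x \<in> B" for x
  proof -
    obtain f where "f \<in> A p" "G x = f0 x + of_int (m f) * (x $ i - of_int T)" using Gm x B by blast
    then show ?thesis using Bi[OF x] by (auto simp: \<mu>_def)
  qed
  have "\<mu> constant_on B"
  proof (rule continuous_finite_range_constant)
    show "connected B" unfolding B_def by (intro convex_connected convex_Int convex_box convex_halfspace_gt)
    show "finite (\<mu> ` B)" using \<mu> by (intro finite_surj[OF finA]) (rule image_subsetI)
    show "continuous_on B \<mu>"
      unfolding \<mu>_def using Bi continuous_on_subset[OF F(1)]
        continuous_on_subset[OF continuous_integer_affine[OF F(3)[OF f0(1)]]]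
      by (intro continuous_intros) auto
  qed
  then obtain y where y: "\<And>x. x \<in> B \<Longrightarrow> \<mu> x = y" unfolding constant_on_def by blast
  obtain M :: int where M: "\<And>x. x \<in> B \<Longrightarrow> \<mu> x = of_int M"
  proof (cases "B = {}")
    case False
    then obtain b where "b \<in> B" by blast
    then obtain f where "y = of_int (m f)" using \<mu>[of b] y by auto
    then show ?thesis using that y by blast
  qed (use that in auto)
  \<comment> \<open>Only the normal coefficient of \<open>f0\<close> is corrected, so
    \<open>c j\<close> survives; the constant is adjusted so that nothing changes on the
    facet.\<close>
  have "G x = (\<Sum>k\<in>UNIV. of_int ((c(i := c i + M)) k) * x $ k) + of_int (d - M * T)"
    if x: "x \<in> unit_cube" "\<forall>k. \<bar>x $ k - p $ k\<bar> < \<epsilon>" for x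
  proof -
    have x01: "0 \<le> x $ i" "x $ i \<le> 1" using x by (auto simp: mem_box_cart)
    have "G x = f0 x + of_int M * (x $ i - of_int T)"
    proof (cases "x $ i = of_int T")
      case True
      then show ?thesis using Gm[OF x(2)] by auto
    next
      case False
      then have "x \<in> B" using x01 x(2) T by (auto simp: B \<sigma>_def)
      then show ?thesis using M[of x] False by (simp add: \<mu>_def field_simps)
    qed
    moreover have "(\<Sum>k\<in>UNIV. of_int ((c(i := c i + M)) k) * x $ k)
        = (\<Sum>k\<in>UNIV. of_int (c k) * x $ k + (if k = i then of_int M * x $ i else 0))"
      by (rule sum.cong) (auto simp: algebra_simps)
    ultimately show ?thesis by (simp add: c sum.distrib algebra_simps)
  qed
  moreover have "(c(i := c i + M)) j \<noteq> 0" using j by simp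
  ultimately show ?thesis using that[of j "c(i := c i + M)" p \<epsilon> "d - M * T"] j(1) prat pi p01 \<epsilon>(1) by auto
qed

section \<open>From the boundary to a single facet\<close>

text \<open>If \<open>G\<close> were constant on each facet, any boundary point could be joined to
  the origin through two facets: setting a coordinate other than \<open>i\<close> to 0 stays in a
  facet orthogonal to axis \<open>i\<close> and reaches one containing the origin. This takes a
  second coordinate; in dimension one the facets are two separate points.\<close>

lemma nonconstant_on_some_facet:
  fixes G :: "real ^ 'n \<Rightarrow> real"
  assumes card: "CARD('n) \<ge> 2" and nc: "\<not> G constant_on frontier unit_cube"
  shows "\<exists>i (T :: int). (T = 0 \<or> T = 1) \<and> \<not> G constant_on {x \<in> unit_cube. x $ i = of_int T}"
proof (rule ccontr)
  assume "\<not> ?thesis"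
  then have const: "G constant_on {x \<in> unit_cube. x $ i = of_int T}" if "T = 0 \<or> T = 1" for i and T :: int
    using that by blast
  have eq: "G x = G y"
    if xy: "x \<in> unit_cube" "y \<in> unit_cube" "x $ i = y $ i" "x $ i = 0 \<or> x $ i = 1" for x y i
  proof -
    obtain T :: int where "T = 0 \<or> T = 1" "x $ i = of_int T" using xy(4) by (metis of_int_0 of_int_1)
    then show ?thesis
      using const[of T i] xy unfolding constant_on_def by auto
  qed
  have "G x = G 0" if x: "x \<in> frontier unit_cube" for x
  proof -
    have xc: "x \<in> unit_cube" using x by (auto simp: frontier_cbox)
    have "\<exists>i. x $ i = 0 \<or> x $ i = 1"
      using x unfolding frontier_cbox by (auto simp: mem_box_cart) (metis order_le_less)+
    then obtain i where i: "x $ i = 0 \<or> x $ i = 1" by blast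
    have "UNIV \<noteq> {i}"
    proof
      assume "UNIV = {i}"
      then have "CARD('n) = card {i}" by (rule arg_cong)
      then show False using card by simp
    qed
    then obtain l where l: "l \<noteq> i" by auto
    define y where "y = (\<chi> k. if k = l then 0 else x $ k)"
    have yc: "y \<in> unit_cube" using xc by (auto simp: y_def mem_box_cart)
    have "G x = G y" using xc yc i l by (intro eq[of _ _ i]) (auto simp: y_def)
    also have "\<dots> = G 0" using yc by (intro eq[of _ _ l]) (auto simp: y_def mem_box_cart)
    finally show ?thesis .
  qed
  then show False using nc unfolding constant_on_def by blast
qed

section \<open>Construction of \<alpha> and \<theta>, and attainment of \<open>z\<close>\<close>

theorem theorem4p7:
  fixes \<eta> :: "real ^ 'n \<Rightarrow> real" and z :: int
  assumes "CARD('n) \<ge> 2"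
    and "Z_map_on unit_cube UNIV \<eta>"
    and "\<not> \<eta> constant_on frontier unit_cube"
  shows "\<exists>(\<theta> :: real ^ 'n \<Rightarrow> real) (\<alpha> :: real ^ 'n \<Rightarrow> real ^ 'n).
           Z_map_on unit_cube UNIV \<theta> \<and>
           Z_map_on unit_cube unit_cube \<alpha> \<and>
           of_int z \<in> \<theta> ` unit_cube \<and>
           (\<forall>x\<in>unit_cube. \<theta> (\<alpha> x) = \<eta> x)"
proof -
  obtain G where G: "Z_map G" and \<eta>: "\<And>x. x \<in> unit_cube \<Longrightarrow> \<eta> x = G x"
    using assms(2) unfolding Z_map_on_def by blast
  have "\<not> G constant_on frontier unit_cube"
    using assms(3) \<eta> unfolding constant_on_def frontier_cbox by auto
  then obtain i and T :: int where T: "T = 0 \<or> T = 1"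
    and nc: "\<not> G constant_on {x \<in> unit_cube. x $ i = of_int T}"
    using nonconstant_on_some_facet[OF assms(1)] by blast
  obtain p :: "real ^ 'n" and c :: "'n \<Rightarrow> int" and d :: int and j \<epsilon>
    where p: "i \<noteq> j" "c j \<noteq> 0" "\<And>k. p $ k \<in> \<rat>" "p $ i = of_int T"
      "\<And>k. k \<noteq> i \<Longrightarrow> 0 < p $ k \<and> p $ k < 1" "\<epsilon> > 0"
    and aff: "\<And>x. x \<in> unit_cube \<Longrightarrow> \<forall>k. \<bar>x $ k - p $ k\<bar> < \<epsilon> \<Longrightarrow>
       G x = (\<Sum>k\<in>UNIV. of_int (c k) * x $ k) + of_int d"
  proof (rule locally_affine_at_facet[OF G T nc], goal_cases)
    case 1
    show thesis by (rule that[OF 1(2-8)])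
  qed
  obtain t v and w :: "'n \<Rightarrow> int" where t: "Z_map t" "\<And>k. v $ k = of_int (w k)"
    and cv: "(\<Sum>k\<in>UNIV. of_int (c k) * v $ k) = 0"
    and t0: "\<And>x. t x \<ge> 0" and pos: "\<exists>y\<in>unit_cube. t y > 0"
    and absorb: "\<And>x. t (x + t x *\<^sub>R v) = 0"
    and near: "\<And>x. x \<in> unit_cube \<Longrightarrow> t x > 0 \<Longrightarrow> x + t x *\<^sub>R v \<in> unit_cube \<and>
       (\<forall>k. \<bar>x $ k - p $ k\<bar> < \<epsilon> \<and> \<bar>(x + t x *\<^sub>R v) $ k - p $ k\<bar> < \<epsilon>)"
  proof (rule absorbing_shift[where c = c and p = p, OF p(1,2,3) T p(4) _ p(6)], goal_cases)
    case 1
    show ?case using 1(2) by (rule p(5))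
  next
    case 2
    show thesis by (rule that[OF 2(2-8)])
  qed
  define \<alpha> where "\<alpha> = (\<lambda>x. x + t x *\<^sub>R v)"
  \<comment> \<open>Where \<open>t\<close> vanishes, \<open>\<alpha>\<close> is the identity.
    Elsewhere both \<open>x\<close> and \<open>\<alpha> x\<close> lie where \<open>G\<close> is
    affine with gradient \<open>c\<close>, and the displacement is orthogonal to
    \<open>c\<close>.\<close>
  have \<alpha>: "\<alpha> x \<in> unit_cube \<and> G (\<alpha> x) = G x" if x: "x \<in> unit_cube" for x
  proof (cases "t x = 0")
    case False
    then have "t x > 0" using t0[of x] by simp
    note n = near[OF x this]
    have "G (\<alpha> x) = (\<Sum>k\<in>UNIV. of_int (c k) * (x + t x *\<^sub>R v) $ k) + of_int d"
      unfolding \<alpha>_def using n by (intro aff) auto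
    also have "\<dots> = (\<Sum>k\<in>UNIV. of_int (c k) * x $ k) + t x * (\<Sum>k\<in>UNIV. of_int (c k) * v $ k) + of_int d"
      by (simp add: algebra_simps sum.distrib sum_distrib_left)
    also have "\<dots> = G x" unfolding cv using n x by (simp add: aff)
    finally show ?thesis using n by (simp add: \<alpha>_def)
  qed (use x in \<open>simp add: \<alpha>_def\<close>)
  obtain y where y: "y \<in> unit_cube" "t y > 0" using pos by blast
  define \<theta> where "\<theta> = (\<lambda>K x. G x + real_of_int K * t x)"
  have Z\<theta>: "Z_map (\<theta> K)" for K unfolding \<theta>_def using G t(1) by (intro Z_map_add Z_map_scale)
  have \<theta>\<alpha>: "\<theta> K (\<alpha> x) = G x" if "x \<in> unit_cube" for K x
    using \<alpha>[OF that] absorb[of x] by (simp add: \<theta>_def \<alpha>_def)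
  have conn: "connected (\<theta> K ` unit_cube)" for K
    using Z\<theta>[of K] unfolding Z_map_def
    by (intro connected_continuous_image) (auto intro: continuous_on_subset convex_connected)
  \<comment> \<open>The value \<open>G y\<close> is attained by every \<open>\<theta> K\<close>,
    namely at \<open>\<alpha> y\<close>, while \<open>\<theta> K y\<close> can be pushed beyond
    \<open>z\<close> in either direction by the choice of \<open>K\<close>, as
    \<open>t y > 0\<close>.\<close>
  have img: "\<theta> K y \<in> \<theta> K ` unit_cube" "G y \<in> \<theta> K ` unit_cube" for K
    using y \<alpha>[OF y(1)] \<theta>\<alpha>[OF y(1), of K, symmetric] by auto
  have "\<exists>K. of_int z \<in> \<theta> K ` unit_cube"
  proof (cases "G y \<le> of_int z")
    case True
    obtain K :: int where "of_int K > (of_int z - G y) / t y" using ex_less_of_int by blast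
    then have "of_int z \<le> \<theta> K y" using y by (simp add: \<theta>_def field_simps)
    then show ?thesis using connectedD_interval[OF conn img(2) img(1)] True by blast
  next
    case False
    obtain K :: int where "of_int K < (of_int z - G y) / t y" using ex_of_int_less by blast
    then have "\<theta> K y \<le> of_int z" using y by (simp add: \<theta>_def field_simps)
    then show ?thesis using connectedD_interval[OF conn img(1) img(2)] False by force
  qed
  then obtain K where K: "of_int z \<in> \<theta> K ` unit_cube" by blast
  have "Z_map \<alpha>" unfolding \<alpha>_def using t by (rule Z_map_shift)
  then have "Z_map_on unit_cube unit_cube \<alpha>" "Z_map_on unit_cube UNIV (\<theta> K)"
    using \<alpha> Z\<theta> unfolding Z_map_on_def by blast+
  then show ?thesis using K \<theta>\<alpha> \<eta> by (intro exI[of _ "\<theta> K"] exI[of _ \<alpha>]) auto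
qed

end
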